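(* Let $r\le m$ be positive integers, and let $x\in\mathbb{R}^m$ be a random variable distributed as a mixture of spherical Gaussians, with probability density $\sum_{j=1}^r \omega_j\,\mathcal{N}(\,\cdot\,|\,\mu_j,\sigma_j^2 I_m)$, where $\sum_{j=1}^r\omega_j=1$ and $\sigma_j^2>0$. Assume that $\omega_i>0$ for $i\in\{1,\dots,r\}$ and that $\mu_1,\dots,\mu_r\in\mathbb{R}^m$ are linearly independent. Let $M_1(\mathbf{X}),M_2(\mathbf{X}),M_3(\mathbf{X})$ be the homogeneous polynomials (symmetric tensors) of degrees $1,2,3$ built from the moments of $x$ as defined in the context. Then the symmetric tensor $M_3(\mathbf{X})$ is identifiable, is of rank $r$, and has a unique (up to permutation of its terms) Waring decomposition satisfying $$M_1(\mathbf{X})=\sum_{i=1}^r\omega_i\,\sigma_i^2\,(\mu_i\cdot\mathbf{X}),\qquad M_2(\mathbf{X})=\sum_{i=1}^r\omega_i\,(\mu_i\cdot\mathbf{X})^2,\qquad M_3(\mathbf{X})=\sum_{i=1}^r\omega_i\,(\mu_i\cdot\mathbf{X})^3.$$ That is, these three relations hold, and whenever $\omega_i'\in\mathbb{C}$, $\mu_i'\in\mathbb{C}^m$ $(1\le i\le r)$ are such that $M_3(\mathbf{X})=\sum_{i=1}^r\omega'_i(\mu'_i\cdot\mathbf{X})^3$, $M_2(\mathbf{X})=\sum_{i=1}^r\omega'_i(\mu'_i\cdot\mathbf{X})^2$ and $M_1(\mathbf{X})=\sum_{i=1}^r\omega'_i\tau_i(\mu'_i\cdot\mathbf{X})$ for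 some scalars $\tau_i\in\mathbb{C}$, there is a permutation $\pi$ of $\{1,\dots,r\}$ with $(\omega'_i,\mu'_i)=(\omega_{\pi(i)},\mu_{\pi(i)})$ for all $i$.
   Context: $\mathbf{X}=(X_1,\dots,X_m)$ are variables. For $\xi\in\mathbb{C}^m$, $(\xi\cdot\mathbf{X})=\sum_{j=1}^m\xi_jX_j$ (no conjugation), and $\|\mathbf{X}\|^2=\sum_{j=1}^m X_j^2$. $\mathcal{N}(\cdot|\mu,\Sigma)$ is the Gaussian density on $\mathbb{R}^m$ with mean $\mu$ and covariance $\Sigma$; $I_m$ is the identity matrix. Moment tensors. Let $\tilde\sigma^2$ be the smallest eigenvalue of the covariance matrix $\mathbb{E}[(x-\mathbb{E}[x])\otimes(x-\mathbb{E}[x])]$ and $v\in\mathbb{R}^m$ a corresponding unit eigenvector. Define $M_1(\mathbf{X})=\mathbb{E}[(x\cdot\mathbf{X})\,(v\cdot(x-\mathbb{E}[x]))^2]$, $M_2(\mathbf{X})=\mathbb{E}[(x\cdot\mathbf{X})^2]-\tilde\sigma^2\|\mathbf{X}\|^2$, $M_3(\mathbf{X})=\mathbb{E}[(x\cdot\mathbf{X})^3]-3\|\mathbf{X}\|^2M_1(\mathbf{X})$. Symmetric tensors of order $d$ are identified with homogeneous polynomials of degree $d$ in $\mathbf{X}$. A decomposition of such a $T$ is an expression $T(\mathbf{X})=\sum_{i=1}^{s}\omega_i(\xi_i\cdot\mathbf{X})^d$ with $\omega_i\in\mathbb{C}$, $\xi_i\in\mathbb{C}^m$. The rank of $T$ is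 the minimal number $s$ of terms in such a decomposition, and a decomposition with the minimal number of terms is called a rank (or Waring) decomposition. $T$ is identifiable if its Waring decomposition is unique in the sense that the lines spanned by $\xi_1,\dots,\xi_s$ form a unique set of lines with no repetition (i.e. the $s$ lines $\mathbb{C}\xi_i$ are pairwise distinct, and every Waring decomposition of $T$ gives the same set of lines). *)

theory Defs
  imports "HOL-Probability.Probability"
begin

section \<open>Forms and Waring decompositions\<close>

text \<open>
  A form of degree \<open>d\<close> in the variables \<open>X\<^sub>j\<close> (indexed by the finite type \<open>'m\<close>) is represented by
  its polynomial function on the complex space of vectors \<open>X\<close>. The complex field being infinite,
  two polynomials are equal if and only if their polynomial functions are.
\<close>

definition cdot :: "complex ^ 'm \<Rightarrow> complex ^ 'm \<Rightarrow> complex" where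
  \<comment> \<open>bilinear, without conjugation\<close>
  "cdot \<xi> X = (\<Sum>j\<in>UNIV. \<xi> $ j * X $ j)"

definition sqnorm_form :: "complex ^ 'm \<Rightarrow> complex" where
  "sqnorm_form X = (\<Sum>j\<in>UNIV. (X $ j) ^ 2)"

definition cvec :: "real ^ 'm \<Rightarrow> complex ^ 'm" where
  "cvec u = (\<chi> j. complex_of_real (u $ j))"

definition decomposition ::
  "nat \<Rightarrow> (complex ^ 'm \<Rightarrow> complex) \<Rightarrow> nat \<Rightarrow> (nat \<Rightarrow> complex) \<Rightarrow> (nat \<Rightarrow> complex ^ 'm) \<Rightarrow> bool" where
  "decomposition d T s w \<xi> \<longleftrightarrow> (\<forall>X. T X = (\<Sum>i=1..s. w i * (cdot (\<xi> i) X) ^ d))"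

text \<open>
  Every form of degree \<open>d\<close> over the complex numbers has a decomposition, so the minimum exists
  whenever \<open>T\<close> is a form of degree \<open>d\<close>.
\<close>

definition waring_rank :: "nat \<Rightarrow> (complex ^ 'm \<Rightarrow> complex) \<Rightarrow> nat" where
  "waring_rank d T = (LEAST s. \<exists>w \<xi>. decomposition d T s w \<xi>)"

definition waring_decomposition ::
  "nat \<Rightarrow> (complex ^ 'm \<Rightarrow> complex) \<Rightarrow> (nat \<Rightarrow> complex) \<Rightarrow> (nat \<Rightarrow> complex ^ 'm) \<Rightarrow> bool" where
  "waring_decomposition d T w \<xi> \<longleftrightarrow> decomposition d T (waring_rank d T) w \<xi>"

text \<open>
  \<open>vec.span {\<xi>}\<close> is the complex line spanned by \<open>\<xi>\<close> (the unqualified \<open>span\<close> would be the real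
  span). In a Waring decomposition of degree \<open>d \<ge> 1\<close> all \<open>\<xi> i\<close> are nonzero by minimality.
\<close>

definition identifiable :: "nat \<Rightarrow> (complex ^ 'm \<Rightarrow> complex) \<Rightarrow> bool" where
  "identifiable d T \<longleftrightarrow>
     (\<exists>w \<xi>. waring_decomposition d T w \<xi>) \<and>
     (\<exists>L. \<forall>w \<xi>. waring_decomposition d T w \<xi> \<longrightarrow>
        inj_on (\<lambda>i. vec.span {\<xi> i}) {1..waring_rank d T} \<and>
        (\<lambda>i. vec.span {\<xi> i}) ` {1..waring_rank d T} = L)"


section \<open>Gaussian densities and moment tensors\<close>

definition gaussian_density :: "real ^ 'm \<Rightarrow> real ^ 'm ^ 'm \<Rightarrow> real ^ 'm \<Rightarrow> real" where
  "gaussian_density \<mu> \<Sigma> y =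
     exp (- ((y - \<mu>) \<bullet> (matrix_inv \<Sigma> *v (y - \<mu>))) / 2) / sqrt ((2 * pi) ^ CARD('m) * det \<Sigma>)"

definition covariance_matrix :: "'a measure \<Rightarrow> ('a \<Rightarrow> real ^ 'm) \<Rightarrow> real ^ 'm ^ 'm" where
  "covariance_matrix P x =
     (\<chi> i j. \<integral>w. (x w - integral\<^sup>L P x) $ i * (x w - integral\<^sup>L P x) $ j \<partial>P)"

definition is_eigenvalue :: "real ^ 'm ^ 'm \<Rightarrow> real \<Rightarrow> bool" where
  "is_eigenvalue A l \<longleftrightarrow> (\<exists>u. u \<noteq> 0 \<and> A *v u = l *\<^sub>R u)"

definition smallest_eigenvalue :: "real ^ 'm ^ 'm \<Rightarrow> real" where
  "smallest_eigenvalue A = (LEAST l. is_eigenvalue A l)"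

definition moment1 ::
  "'a measure \<Rightarrow> ('a \<Rightarrow> real ^ 'm) \<Rightarrow> real ^ 'm \<Rightarrow> complex ^ 'm \<Rightarrow> complex" where
  "moment1 P x v X =
     (\<integral>w. cdot (cvec (x w)) X * complex_of_real ((v \<bullet> (x w - integral\<^sup>L P x)) ^ 2) \<partial>P)"

definition moment2 :: "'a measure \<Rightarrow> ('a \<Rightarrow> real ^ 'm) \<Rightarrow> complex ^ 'm \<Rightarrow> complex" where
  "moment2 P x X =
     (\<integral>w. (cdot (cvec (x w)) X) ^ 2 \<partial>P)
     - complex_of_real (smallest_eigenvalue (covariance_matrix P x)) * sqnorm_form X"

definition moment3 ::
  "'a measure \<Rightarrow> ('a \<Rightarrow> real ^ 'm) \<Rightarrow> real ^ 'm \<Rightarrow> complex ^ 'm \<Rightarrow> complex" where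
  "moment3 P x v X =
     (\<integral>w. (cdot (cvec (x w)) X) ^ 3 \<partial>P) - 3 * sqnorm_form X * moment1 P x v X"

end

theory Submission
  imports Defs
begin

text \<open>
  The two halves of the argument meet in the formula for \<open>moment3\<close>.

  The probabilistic half computes moments. Under a Gaussian component with centre \<open>\<mu> j\<close> and covariance
  \<open>(\<sigma> j)\<^sup>2\<close> times the identity, write \<open>x\<close> as its centre plus a centred part; odd moments of the centred part
  vanish and the second ones are those of a multiple of the identity. The covariance of the mixture is
  therefore the spread of the centres around their mean plus the averaged variance times the identity.
  The spread is positive semidefinite of rank less than \<open>r\<close>, and \<open>r\<close> is at most the dimension, so the
  smallest eigenvalue is exactly the averaged variance, and \<open>v\<close> is orthogonal to all deviations of the
  centres from their mean (\<open>smallest_eigenvalue_covariance\<close>, \<open>smallest_eigenvector_orthogonal\<close>).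
  Consequently the subtracted terms in \<open>moment2\<close> and \<open>moment3\<close> remove exactly the contributions of the
  variances, and the weighted powers of the centres remain.

  The algebraic half shows that a sum of \<open>r\<close> cubes of independent linear forms with nonzero weights has,
  up to order and rescaling of the forms, no other decomposition of length at most \<open>r\<close>. Polarization turns two decompositions into equal
  trilinear forms. Contracting these with dual vectors of the \<open>\<mu> i\<close> puts every \<open>\<mu> i\<close> in the span of the
  other family \<open>\<xi> k\<close>; so that family has at least \<open>r\<close> members, and if it has exactly \<open>r\<close> it is independent
  as well. Contracting with dual vectors of both families then matches each line of one family with a line
  of the other (\<open>cubic_decomposition_line\<close>), which gives the rank and identifiability. The scalars that
  remain free on each line are fixed by comparing the cubic with the quadratic form
  (\<open>square_and_cube_decomposition_unique\<close>).
\<close>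

section \<open>Bilinear pairing and dual vectors\<close>

lemma cdot_zero_left [simp]: "cdot 0 X = 0"
  by (simp add: cdot_def)

lemma cdot_zero_right [simp]: "cdot \<xi> 0 = 0"
  by (simp add: cdot_def)

lemma cdot_add_right: "cdot \<xi> (X + Y) = cdot \<xi> X + cdot \<xi> Y"
  by (simp add: cdot_def distrib_left sum.distrib)

lemma cdot_scale_left: "cdot (c *s \<xi>) X = c * cdot \<xi> X"
  by (simp add: cdot_def sum_distrib_left mult.assoc)

lemma cdot_sum_left: "cdot (\<Sum>i\<in>I. f i) X = (\<Sum>i\<in>I. cdot (f i) X)"
  by (simp add: cdot_def sum_distrib_right) (rule sum.swap)

lemma cdot_axis_right: "cdot \<xi> (axis j 1) = \<xi> $ j"
proof -
  have "cdot \<xi> (axis j 1) = (\<Sum>i\<in>UNIV. if i = j then \<xi> $ i else 0)"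
    unfolding cdot_def by (intro sum.cong) (auto simp: axis_def)
  then show ?thesis by simp
qed

lemma cdot_eqI: "(\<And>X. cdot \<xi> X = cdot \<eta> X) \<Longrightarrow> \<xi> = \<eta>"
  by (metis cdot_axis_right vec_eq_iff)

lemma cdot_cvec: "cdot (cvec a) (cvec b) = complex_of_real (a \<bullet> b)"
  by (simp add: cdot_def cvec_def inner_vec_def)

text \<open>
  A family \<open>\<xi>\<close> has dual vectors exactly when it is linearly independent as an indexed family. In this
  form independence is used by evaluating linear forms at the \<open>e j\<close>.
\<close>
definition dual_vectors ::
  "'i set \<Rightarrow> ('i \<Rightarrow> complex ^ 'm) \<Rightarrow> ('i \<Rightarrow> complex ^ 'm) \<Rightarrow> bool" where
  "dual_vectors I \<xi> e \<longleftrightarrow> (\<forall>i\<in>I. \<forall>j\<in>I. cdot (\<xi> i) (e j) = (if i = j then 1 else 0))"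

lemma dual_vectorsD:
  "dual_vectors I \<xi> e \<Longrightarrow> i \<in> I \<Longrightarrow> j \<in> I \<Longrightarrow> cdot (\<xi> i) (e j) = (if i = j then 1 else 0)"
  by (auto simp: dual_vectors_def)

lemma dual_vectors_inj_on:
  assumes "dual_vectors I \<xi> e"
  shows "inj_on \<xi> I"
proof (rule inj_onI)
  fix i j assume i: "i \<in> I" and j: "j \<in> I" and eq: "\<xi> i = \<xi> j"
  have "(if j = i then 1 else 0) = cdot (\<xi> i) (e i)"
    unfolding eq using i j by (rule dual_vectorsD[OF assms, symmetric, rotated])
  also have "\<dots> = 1" using i by (simp add: dual_vectorsD[OF assms])
  finally show "i = j" by (simp split: if_splits)
qed

lemma dual_vectors_independent:
  assumes dual: "dual_vectors I \<xi> e" and fin: "finite I"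
  shows "vec.independent (\<xi> ` I)"
proof (rule vec.independent_if_scalars_zero)
  show "finite (\<xi> ` I)" using fin by simp
  fix f x assume sum0: "(\<Sum>x\<in>\<xi> ` I. f x *s x) = 0" and "x \<in> \<xi> ` I"
  then obtain i where i: "i \<in> I" "x = \<xi> i" by blast
  have "0 = cdot (\<Sum>x\<in>\<xi> ` I. f x *s x) (e i)" by (simp add: sum0)
  also have "\<dots> = (\<Sum>j\<in>I. f (\<xi> j) * cdot (\<xi> j) (e i))"
    by (simp add: sum.reindex[OF dual_vectors_inj_on[OF dual]] cdot_sum_left cdot_scale_left)
  also have "\<dots> = (\<Sum>j\<in>I. if j = i then f (\<xi> j) else 0)"
    using i by (intro sum.cong) (auto simp: dual_vectorsD[OF dual])
  also have "\<dots> = f x" using i fin by simp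
  finally show "f x = 0" by (rule sym)
qed

text \<open>
  A linear map that sends \<open>\<xi> j\<close> to a coordinate vector and the other members of the family to zero has
  one row of its matrix equal to the wanted dual vector.
\<close>
lemma independent_imp_dual_vectors:
  fixes \<xi> :: "'i \<Rightarrow> complex ^ 'm"
  assumes ind: "vec.independent (\<xi> ` I)" and inj: "inj_on \<xi> I"
  obtains e where "dual_vectors I \<xi> e"
proof -
  \<comment> \<open>an arbitrary coordinate, used to see the scalars inside the vector space\<close>
  fix k :: 'm
  have "\<exists>f. \<forall>i\<in>I. cdot (\<xi> i) f = (if i = j then 1 else 0)" if "j \<in> I" for j
  proof -
    obtain g :: "complex ^ 'm \<Rightarrow> complex ^ 'm" where lin: "Vector_Spaces.linear (*s) (*s) g"
      and g: "\<forall>x\<in>\<xi> ` I. g x = (if x = \<xi> j then axis k 1 else 0)"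
      using vec.linear_independent_extend[OF ind, of "\<lambda>x. if x = \<xi> j then axis k 1 else 0"]
      by blast
    have "cdot (\<xi> i) (matrix g $ k) = (if i = j then 1 else 0)" if "i \<in> I" for i
    proof -
      have "cdot (\<xi> i) (matrix g $ k) = (matrix g *v \<xi> i) $ k"
        by (simp add: cdot_def matrix_vector_mult_def mult.commute)
      also have "\<dots> = g (\<xi> i) $ k" by (simp add: matrix_works[OF lin])
      also have "\<dots> = (if i = j then 1 else 0)"
        using g inj \<open>i \<in> I\<close> \<open>j \<in> I\<close> by (auto simp: inj_on_def axis_def)
      finally show ?thesis .
    qed
    then show ?thesis by blast
  qed
  then obtain e where "\<forall>j\<in>I. \<forall>i\<in>I. cdot (\<xi> i) (e j) = (if i = j then 1 else 0)"
    by metis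
  then have "dual_vectors I \<xi> e" by (auto simp: dual_vectors_def)
  then show ?thesis by (rule that)
qed

text \<open>
  Real dual vectors of a real family stay dual after complexification, so independence over the reals
  gives independence over the complex numbers.
\<close>
lemma real_independent_imp_dual_vectors:
  fixes \<mu> :: "'i \<Rightarrow> real ^ 'm"
  assumes ind: "independent (\<mu> ` I)" and inj: "inj_on \<mu> I"
  obtains e where "dual_vectors I (\<lambda>i. cvec (\<mu> i)) e"
proof -
  have "\<exists>f. \<forall>i\<in>I. \<mu> i \<bullet> f = (if i = j then 1 else 0)" if "j \<in> I" for j
  proof -
    obtain g :: "real ^ 'm \<Rightarrow> real" where lin: "linear g"
      and g: "\<forall>x\<in>\<mu> ` I. g x = (if x = \<mu> j then 1 else 0)"
      using linear_independent_extend[OF ind, of "\<lambda>x. if x = \<mu> j then 1 else (0::real)"]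
      by blast
    have "\<mu> i \<bullet> adjoint g 1 = g (\<mu> i)" for i
      using adjoint_works[OF lin, of "\<mu> i" 1] by simp
    then have "\<forall>i\<in>I. \<mu> i \<bullet> adjoint g 1 = (if i = j then 1 else 0)"
      using g inj \<open>j \<in> I\<close> by (auto simp: inj_on_def)
    then show ?thesis by blast
  qed
  then obtain e where "\<forall>j\<in>I. \<forall>i\<in>I. \<mu> i \<bullet> e j = (if i = j then 1 else 0)"
    by metis
  then have "dual_vectors I (\<lambda>i. cvec (\<mu> i)) (\<lambda>i. cvec (e i))"
    by (auto simp: dual_vectors_def cdot_cvec)
  then show ?thesis by (rule that)
qed

section \<open>Uniqueness of decompositions of cubic forms with independent vectors\<close>

text \<open>
  Polarization: a cubic form determines its symmetric trilinear form, by
  \<open>6xyz = (x+y+z)^3 - (x+y)^3 - (x+z)^3 - (y+z)^3 + x^3 + y^3 + z^3\<close>.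
\<close>
lemma cubes_eq_imp_trilinear_eq:
  assumes "\<And>X. (\<Sum>i\<in>I. a i * cdot (\<alpha> i) X ^ 3) = (\<Sum>k\<in>K. b k * cdot (\<beta> k) X ^ 3)"
  shows "(\<Sum>i\<in>I. a i * cdot (\<alpha> i) X * cdot (\<alpha> i) Y * cdot (\<alpha> i) Z)
       = (\<Sum>k\<in>K. b k * cdot (\<beta> k) X * cdot (\<beta> k) Y * cdot (\<beta> k) Z)"
proof -
  have polar: "6 * (\<Sum>i\<in>I. a i * cdot (\<alpha> i) X * cdot (\<alpha> i) Y * cdot (\<alpha> i) Z) =
      (\<Sum>i\<in>I. a i * cdot (\<alpha> i) (X + Y + Z) ^ 3) - (\<Sum>i\<in>I. a i * cdot (\<alpha> i) (X + Y) ^ 3)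
    - (\<Sum>i\<in>I. a i * cdot (\<alpha> i) (X + Z) ^ 3) - (\<Sum>i\<in>I. a i * cdot (\<alpha> i) (Y + Z) ^ 3)
    + (\<Sum>i\<in>I. a i * cdot (\<alpha> i) X ^ 3) + (\<Sum>i\<in>I. a i * cdot (\<alpha> i) Y ^ 3)
    + (\<Sum>i\<in>I. a i * cdot (\<alpha> i) Z ^ 3)"
    for I :: "'x set" and a and \<alpha> :: "'x \<Rightarrow> complex ^ 'm" and X Y Z
    unfolding sum_distrib_left sum.distrib[symmetric] sum_subtractf[symmetric]
    by (intro sum.cong refl) (simp only: cdot_add_right, algebra)
  have "6 * (\<Sum>i\<in>I. a i * cdot (\<alpha> i) X * cdot (\<alpha> i) Y * cdot (\<alpha> i) Z)
      = 6 * (\<Sum>k\<in>K. b k * cdot (\<beta> k) X * cdot (\<beta> k) Y * cdot (\<beta> k) Z)"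
    unfolding polar assms ..
  then show ?thesis by simp
qed

text \<open>
  Both decompositions give the same trilinear form. Inserting the dual vector \<open>e i\<close> in one slot leaves
  only the term \<open>\<mu> i\<close> on one side; \<open>X\<close> fills the second slot, and the third one is left open, which
  turns the scalar identity into an identity of vectors.
\<close>
lemma cubic_decomposition_contract:
  assumes dual: "dual_vectors {1..r} \<mu> e"
    and T: "decomposition 3 T r w \<mu>" and T': "decomposition 3 T s w' \<xi>"
    and i: "i \<in> {1..r}"
  shows "(w i * cdot (\<mu> i) X) *s \<mu> i = (\<Sum>k=1..s. (w' k * cdot (\<xi> k) X * cdot (\<xi> k) (e i)) *s \<xi> k)"
proof (rule cdot_eqI)
  fix Z
  have "(\<Sum>j=1..r. w j * cdot (\<mu> j) X * cdot (\<mu> j) (e i) * cdot (\<mu> j) Z)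
      = (\<Sum>k=1..s. w' k * cdot (\<xi> k) X * cdot (\<xi> k) (e i) * cdot (\<xi> k) Z)"
    using T T' by (intro cubes_eq_imp_trilinear_eq) (simp add: decomposition_def)
  moreover have "(\<Sum>j=1..r. w j * cdot (\<mu> j) X * cdot (\<mu> j) (e i) * cdot (\<mu> j) Z)
      = (\<Sum>j=1..r. if j = i then w j * cdot (\<mu> j) X * cdot (\<mu> j) Z else 0)"
    using i by (intro sum.cong) (auto simp: dual_vectorsD[OF dual])
  ultimately show "cdot ((w i * cdot (\<mu> i) X) *s \<mu> i) Z =
      cdot (\<Sum>k=1..s. (w' k * cdot (\<xi> k) X * cdot (\<xi> k) (e i)) *s \<xi> k) Z"
    using i by (simp add: cdot_sum_left cdot_scale_left)
qed

text \<open>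
  Contract with \<open>e i\<close> twice: what is left is \<open>w i\<close> times \<open>\<mu> i\<close>.
\<close>
lemma cubic_decomposition_span:
  assumes dual: "dual_vectors {1..r} \<mu> e" and w: "\<forall>i\<in>{1..r}. w i \<noteq> 0"
    and T: "decomposition 3 T r w \<mu>" and T': "decomposition 3 T s w' \<xi>"
  shows "\<mu> ` {1..r} \<subseteq> vec.span (\<xi> ` {1..s})"
proof clarify
  fix i assume i: "i \<in> {1..r}"
  have "w i *s \<mu> i = (\<Sum>k=1..s. (w' k * cdot (\<xi> k) (e i) * cdot (\<xi> k) (e i)) *s \<xi> k)"
    using cubic_decomposition_contract[OF dual T T' i, of "e i"] i by (simp add: dual_vectorsD[OF dual])
  also have "\<dots> \<in> vec.span (\<xi> ` {1..s})"
    by (intro vec.span_sum vec.span_scale vec.span_base) auto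
  finally have "inverse (w i) *s (w i *s \<mu> i) \<in> vec.span (\<xi> ` {1..s})"
    by (rule vec.span_scale)
  with w i show "\<mu> i \<in> vec.span (\<xi> ` {1..s})" by simp
qed

lemma cubic_decomposition_length_ge:
  assumes dual: "dual_vectors {1..r} \<mu> e" and w: "\<forall>i\<in>{1..r}. w i \<noteq> 0"
    and T: "decomposition 3 T r w \<mu>" and T': "decomposition 3 T s w' \<xi>"
  shows "r \<le> s"
proof -
  have "card (\<mu> ` {1..r}) \<le> card (\<xi> ` {1..s})"
    using vec.independent_span_bound[OF _ dual_vectors_independent[OF dual]
        cubic_decomposition_span[OF assms]] by simp
  also have "\<dots> \<le> s" using card_image_le[of "{1..s}" \<xi>] by simp
  finally show ?thesis unfolding card_image[OF dual_vectors_inj_on[OF dual]] by simp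
qed

text \<open>
  The \<open>r\<close> vectors \<open>\<xi> k\<close> span the \<open>r\<close> independent vectors \<open>\<mu> i\<close>, hence are independent themselves and
  have dual vectors \<open>f k\<close>. Contracting the tensor with \<open>e i\<close> and \<open>f k\<close> isolates one term on each side and
  yields a multiple of \<open>\<mu> i\<close> equal to a multiple of \<open>\<xi> k\<close>. The first multiple is nonzero for some \<open>k\<close>,
  because a vector in the span of the \<open>\<xi> k\<close> killed by all \<open>f k\<close> is zero.
\<close>
lemma cubic_decomposition_line:
  assumes dual: "dual_vectors {1..r} \<mu> e" and w: "\<forall>i\<in>{1..r}. w i \<noteq> 0"
    and T: "decomposition 3 T r w \<mu>" and T': "decomposition 3 T r w' \<xi>"
    and i: "i \<in> {1..r}"
  shows "\<exists>k\<in>{1..r}. \<exists>c. c \<noteq> 0 \<and> \<xi> k = c *s \<mu> i"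
proof -
  have span: "\<mu> ` {1..r} \<subseteq> vec.span (\<xi> ` {1..r})"
    by (rule cubic_decomposition_span[OF assms(1-4)])
  have card_mu: "card (\<mu> ` {1..r}) = r"
    unfolding card_image[OF dual_vectors_inj_on[OF dual]] by simp
  have le: "r \<le> vec.dim (vec.span (\<xi> ` {1..r}))"
    using vec.independent_card_le_dim[OF span dual_vectors_independent[OF dual]] card_mu by simp
  have "vec.dim (vec.span (\<xi> ` {1..r})) \<le> card (\<xi> ` {1..r})"
    by (intro vec.dim_le_card) auto
  with le have card_xi: "card (\<xi> ` {1..r}) = r"
    using card_image_le[of "{1..r}" \<xi>] by simp
  then have inj: "inj_on \<xi> {1..r}" by (intro eq_card_imp_inj_on) auto
  have ind: "vec.independent (\<xi> ` {1..r})"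
    using le card_xi by (intro vec.card_le_dim_spanning[of _ "vec.span (\<xi> ` {1..r})"]) 
      (auto intro: vec.span_base)
  obtain f where f: "dual_vectors {1..r} \<xi> f"
    using independent_imp_dual_vectors[OF ind inj] .
  have "\<exists>k\<in>{1..r}. cdot (\<mu> i) (f k) \<noteq> 0"
  proof (rule ccontr)
    assume "\<not> ?thesis"
    then have z: "cdot (\<mu> i) (f k) = 0" if "k \<in> {1..r}" for k using that by blast
    have "\<mu> i \<in> vec.span (\<xi> ` {1..r})" using span i by blast
    then obtain u where u: "\<mu> i = (\<Sum>x\<in>\<xi> ` {1..r}. u x *s x)"
      using vec.span_finite[of "\<xi> ` {1..r}"] by auto
    have "u (\<xi> k) = 0" if k: "k \<in> {1..r}" for k
    proof -
      have "0 = cdot (\<Sum>j=1..r. u (\<xi> j) *s \<xi> j) (f k)"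
        using z[OF k] unfolding u sum.reindex[OF inj] by simp
      also have "\<dots> = (\<Sum>j=1..r. if j = k then u (\<xi> j) else 0)"
        unfolding cdot_sum_left cdot_scale_left
        using k by (intro sum.cong) (auto simp: dual_vectorsD[OF f])
      finally show ?thesis using k by simp
    qed
    then have "\<mu> i = 0" unfolding u by (intro sum.neutral) auto
    with dual_vectorsD[OF dual i i] show False by simp
  qed
  then obtain k where k: "k \<in> {1..r}" and nz: "cdot (\<mu> i) (f k) \<noteq> 0" by blast
  define a where "a = w i * cdot (\<mu> i) (f k)"
  define b where "b = w' k * cdot (\<xi> k) (e i)"
  have "a *s \<mu> i = (\<Sum>l=1..r. (w' l * cdot (\<xi> l) (f k) * cdot (\<xi> l) (e i)) *s \<xi> l)"
    unfolding a_def by (rule cubic_decomposition_contract[OF dual T T' i])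
  also have "\<dots> = (\<Sum>l=1..r. if l = k then b *s \<xi> l else 0)"
    using k by (intro sum.cong) (auto simp: b_def dual_vectorsD[OF f])
  finally have eq: "a *s \<mu> i = b *s \<xi> k" using k by simp
  have a: "a \<noteq> 0" using w i nz by (simp add: a_def)
  have "b \<noteq> 0"
  proof
    assume "b = 0"
    with eq a have "\<mu> i = 0" by simp
    with dual_vectorsD[OF dual i i] show False by simp
  qed
  then have "\<xi> k = inverse b *s (a *s \<mu> i)" by (simp add: eq)
  then have "\<xi> k = (a / b) *s \<mu> i" by (simp add: field_simps)
  with a \<open>b \<noteq> 0\<close> k show ?thesis by (intro bexI[of _ k] exI[of _ "a / b"]) auto
qed

text \<open>
  The line of each \<open>\<mu> i\<close> occurs among the lines of the \<open>\<xi> k\<close>. The former are pairwise distinct, so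
  choosing such a \<open>k\<close> for every \<open>i\<close> gives an injection of \<open>{1..r}\<close> into itself, and \<open>\<pi>\<close> is its inverse.
\<close>
lemma cubic_decomposition_unique:
  assumes dual: "dual_vectors {1..r} \<mu> e" and w: "\<forall>i\<in>{1..r}. w i \<noteq> 0"
    and T: "decomposition 3 T r w \<mu>" and T': "decomposition 3 T r w' \<xi>"
  obtains \<pi> c where "\<pi> permutes {1..r}"
    and "\<And>k. k \<in> {1..r} \<Longrightarrow> c k \<noteq> 0 \<and> \<xi> k = c k *s \<mu> (\<pi> k)"
proof -
  have "\<forall>i\<in>{1..r}. \<exists>k. k \<in> {1..r} \<and> (\<exists>c. c \<noteq> 0 \<and> \<xi> k = c *s \<mu> i)"
    using cubic_decomposition_line[OF assms] by blast
  then obtain \<kappa> where \<kappa>: "\<forall>i\<in>{1..r}. \<kappa> i \<in> {1..r} \<and> (\<exists>c. c \<noteq> 0 \<and> \<xi> (\<kappa> i) = c *s \<mu> i)"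
    by (auto simp only: bchoice_iff)
  have inj: "inj_on \<kappa> {1..r}"
  proof (rule inj_onI)
    fix i j assume i: "i \<in> {1..r}" and j: "j \<in> {1..r}" and eq: "\<kappa> i = \<kappa> j"
    obtain c d where c: "c \<noteq> 0" "\<xi> (\<kappa> i) = c *s \<mu> i" and d: "\<xi> (\<kappa> j) = d *s \<mu> j"
      using \<kappa> i j by metis
    have "c * cdot (\<mu> i) (e i) = d * cdot (\<mu> j) (e i)"
      using c d eq by (simp flip: cdot_scale_left)
    then show "i = j"
      using c i j by (auto simp: dual_vectorsD[OF dual] split: if_splits)
  qed
  have "\<kappa> ` {1..r} = {1..r}"
    using \<kappa> inj by (intro endo_inj_surj) auto
  with inj have bij: "bij_betw \<kappa> {1..r} {1..r}" by (simp add: bij_betw_def)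
  define \<pi> where "\<pi> = (\<lambda>k. if k \<in> {1..r} then inv_into {1..r} \<kappa> k else k)"
  have "bij_betw \<pi> {1..r} {1..r}"
    using bij_betw_inv_into[OF bij] by (rule bij_betw_cong[THEN iffD1, rotated]) (simp add: \<pi>_def)
  then have perm: "\<pi> permutes {1..r}" by (intro bij_imp_permutes) (auto simp: \<pi>_def)
  have "\<exists>c. c \<noteq> 0 \<and> \<xi> k = c *s \<mu> (\<pi> k)" if k: "k \<in> {1..r}" for k
  proof -
    have "\<kappa> (\<pi> k) = k" using k bij by (simp add: \<pi>_def bij_betw_inv_into_right)
    moreover have "\<pi> k \<in> {1..r}" using perm k by (simp add: permutes_in_image del: atLeastAtMost_iff)
    ultimately show ?thesis using \<kappa> by metis
  qed
  then obtain c where "\<forall>k\<in>{1..r}. c k \<noteq> 0 \<and> \<xi> k = c k *s \<mu> (\<pi> k)"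
    by metis
  with perm show ?thesis by (intro that[of \<pi> c]) blast+
qed

lemma span_singleton_scale:
  fixes x :: "'a::field ^ 'n"
  assumes "c \<noteq> 0"
  shows "vec.span {c *s x} = vec.span {x}"
proof (intro subset_antisym vec.span_minimal)
  show "{c *s x} \<subseteq> vec.span {x}" by (auto intro: vec.span_scale vec.span_base)
  have "inverse c *s (c *s x) \<in> vec.span {c *s x}" by (intro vec.span_scale vec.span_base) auto
  then show "{x} \<subseteq> vec.span {c *s x}" using assms by simp
qed auto

lemma dual_vectors_inj_on_lines:
  assumes dual: "dual_vectors I \<xi> e"
  shows "inj_on (\<lambda>i. vec.span {\<xi> i}) I"
proof (rule inj_onI)
  fix i j assume i: "i \<in> I" and j: "j \<in> I" and "vec.span {\<xi> i} = vec.span {\<xi> j}"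
  then have "\<xi> i \<in> vec.span {\<xi> j}" by (metis singletonI vec.span_base)
  then obtain c where "\<xi> i = c *s \<xi> j" by (auto simp: vec.span_singleton)
  then have "cdot (\<xi> i) (e i) = c * cdot (\<xi> j) (e i)" by (simp add: cdot_scale_left)
  then show "i = j" using i j by (auto simp: dual_vectorsD[OF dual] split: if_splits)
qed

lemma waring_rank_cubic:
  assumes dual: "dual_vectors {1..r} \<mu> e" and w: "\<forall>i\<in>{1..r}. w i \<noteq> 0"
    and T: "decomposition 3 T r w \<mu>"
  shows "waring_rank 3 T = r"
  unfolding waring_rank_def
  using T cubic_decomposition_length_ge[OF assms] by (intro Least_equality) blast+

lemma identifiable_cubic:
  assumes dual: "dual_vectors {1..r} \<mu> e" and w: "\<forall>i\<in>{1..r}. w i \<noteq> 0"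
    and T: "decomposition 3 T r w \<mu>"
  shows "identifiable 3 T"
proof -
  have rank: "waring_rank 3 T = r" by (rule waring_rank_cubic[OF assms])
  have "inj_on (\<lambda>i. vec.span {\<xi> i}) {1..r} \<and>
      (\<lambda>i. vec.span {\<xi> i}) ` {1..r} = (\<lambda>i. vec.span {\<mu> i}) ` {1..r}"
    if T': "decomposition 3 T r w' \<xi>" for w' \<xi>
  proof -
    obtain \<pi> c where perm: "\<pi> permutes {1..r}"
      and c: "\<And>k. k \<in> {1..r} \<Longrightarrow> c k \<noteq> 0 \<and> \<xi> k = c k *s \<mu> (\<pi> k)"
      using cubic_decomposition_unique[OF assms T'] by blast
    let ?L = "\<lambda>i. vec.span {\<mu> i}"
    have line: "vec.span {\<xi> k} = (?L \<circ> \<pi>) k" if "k \<in> {1..r}" for k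
      using c[OF that] by (simp add: span_singleton_scale)
    have "inj_on (?L \<circ> \<pi>) {1..r}"
      using dual_vectors_inj_on_lines[OF dual] perm
      by (intro comp_inj_on) (auto simp: permutes_inj_on permutes_image)
    moreover have "(?L \<circ> \<pi>) ` {1..r} = ?L ` {1..r}"
      by (simp only: image_comp[symmetric] permutes_image[OF perm])
    moreover have "(\<lambda>k. vec.span {\<xi> k}) ` {1..r} = (?L \<circ> \<pi>) ` {1..r}"
      using line by (rule image_cong[OF refl])
    moreover have "inj_on (\<lambda>k. vec.span {\<xi> k}) {1..r} = inj_on (?L \<circ> \<pi>) {1..r}"
      using line by (rule inj_on_cong)
    ultimately show ?thesis by (simp only:)
  qed
  then show ?thesis
    unfolding identifiable_def waring_decomposition_def rank
    by (intro conjI exI[of _ w] exI[of _ \<mu>] exI[of _ "(\<lambda>i. vec.span {\<mu> i}) ` {1..r}"] allI impI T) blast+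
qed

text \<open>
  Evaluate both sides at the dual vector of \<open>\<mu> (\<pi> k)\<close>.
\<close>
lemma diagonal_form_coeff_unique:
  assumes dual: "dual_vectors I \<mu> e" and fin: "finite I" and perm: "\<pi> permutes I"
    and \<xi>: "\<And>k. k \<in> I \<Longrightarrow> \<xi> k = c k *s \<mu> (\<pi> k)"
    and eq: "\<And>X. (\<Sum>i\<in>I. w i * cdot (\<mu> i) X ^ d) = (\<Sum>k\<in>I. w' k * cdot (\<xi> k) X ^ d)"
    and "0 < d" and k: "k \<in> I"
  shows "w' k * c k ^ d = w (\<pi> k)"
proof -
  have mem: "\<pi> l \<in> I" if "l \<in> I" for l using that perm by (simp add: permutes_in_image)
  have "(\<Sum>i\<in>I. w i * cdot (\<mu> i) (e (\<pi> k)) ^ d) = (\<Sum>i\<in>I. if i = \<pi> k then w i else 0)"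
    using k mem \<open>0 < d\<close> by (intro sum.cong) (auto simp: dual_vectorsD[OF dual])
  moreover have "(\<Sum>l\<in>I. w' l * cdot (\<xi> l) (e (\<pi> k)) ^ d)
      = (\<Sum>l\<in>I. if l = k then w' l * c l ^ d else 0)"
    using k mem \<open>0 < d\<close> permutes_inj[OF perm]
    by (intro sum.cong) (auto simp: \<xi> cdot_scale_left dual_vectorsD[OF dual] inj_eq)
  ultimately show ?thesis using eq[of "e (\<pi> k)"] fin k mem by simp
qed

text \<open>
  The cubic form determines the vectors up to permutation and scalars \<open>c k\<close>. Comparing coefficients in
  degree 3 and in degree 2 gives \<open>w' k * c k ^ 3 = w' k * c k ^ 2\<close>, where both sides are a nonzero weight;
  hence \<open>c k = 1\<close>.
\<close>
lemma square_and_cube_decomposition_unique: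
  assumes dual: "dual_vectors {1..r} \<mu> e" and w: "\<forall>i\<in>{1..r}. w i \<noteq> 0"
    and T: "decomposition 3 T r w \<mu>" and T': "decomposition 3 T r w' \<xi>"
    and Q: "decomposition 2 Q r w \<mu>" and Q': "decomposition 2 Q r w' \<xi>"
  shows "\<exists>\<pi>. \<pi> permutes {1..r} \<and> (\<forall>k\<in>{1..r}. w' k = w (\<pi> k) \<and> \<xi> k = \<mu> (\<pi> k))"
proof -
  obtain \<pi> c where perm: "\<pi> permutes {1..r}"
    and c: "\<And>k. k \<in> {1..r} \<Longrightarrow> c k \<noteq> 0 \<and> \<xi> k = c k *s \<mu> (\<pi> k)"
    using cubic_decomposition_unique[OF dual w T T'] by blast
  have "w' k = w (\<pi> k) \<and> \<xi> k = \<mu> (\<pi> k)" if k: "k \<in> {1..r}" for k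
  proof -
    have cube: "w' k * c k ^ 3 = w (\<pi> k)"
      using T T' c k by (intro diagonal_form_coeff_unique[OF dual _ perm]) (auto simp: decomposition_def)
    have square: "w' k * c k ^ 2 = w (\<pi> k)"
      using Q Q' c k by (intro diagonal_form_coeff_unique[OF dual _ perm]) (auto simp: decomposition_def)
    have "\<pi> k \<in> {1..r}" using perm k by (simp add: permutes_in_image del: atLeastAtMost_iff)
    then have nz: "w (\<pi> k) \<noteq> 0" using w by blast
    have "w (\<pi> k) * c k = w (\<pi> k)"
      using cube by (simp flip: square add: power2_eq_square power3_eq_cube mult.assoc)
    with nz have "c k = 1" by simp
    with square c[OF k] show ?thesis by simp
  qed
  with perm show ?thesis by blast
qed

section \<open>Moments of spherical Gaussians\<close>

text \<open>
  Fubini for products of functions of single coordinates. The product measure behind \<open>lborel\<close> is indexed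
  by basis vectors; the coordinates index the same basis through \<open>axis\<close>.
\<close>
lemma has_bochner_integral_lborel_prod:
  fixes f :: "'m::finite \<Rightarrow> real \<Rightarrow> real"
  assumes f: "\<And>i. has_bochner_integral lborel (f i) (I i)"
  shows "has_bochner_integral lborel (\<lambda>x::real ^ 'm. \<Prod>i\<in>UNIV. f i (x $ i)) (\<Prod>i\<in>UNIV. I i)"
proof -
  interpret product_sigma_finite "\<lambda>_::real ^ 'm. lborel :: real measure" ..
  \<comment> \<open>the coordinate functions reindexed by basis vectors\<close>
  let ?g = "\<lambda>b::real ^ 'm. f (THE i. b = axis i 1)"
  have g: "?g (axis i 1) = f i" for i by (simp add: axis_eq_axis)
  have basis: "Basis = (\<lambda>i. axis i 1 :: real ^ 'm) ` UNIV" by (auto simp: Basis_vec_def)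
  have inj: "inj (\<lambda>i. axis i 1 :: real ^ 'm)" by (auto simp: inj_def axis_eq_axis)
  have reindex: "(\<Prod>b\<in>Basis. h b) = (\<Prod>i\<in>UNIV. h (axis i 1))" for h :: "real ^ 'm \<Rightarrow> real"
    unfolding basis by (simp add: prod.reindex[OF inj])
  have int: "integrable lborel (?g b)" if "b \<in> Basis" for b
    using that f by (auto simp: basis g intro: integrable.intros)
  have "integrable (\<Pi>\<^sub>M b\<in>Basis. lborel) (\<lambda>y. \<Prod>b\<in>Basis. ?g b (y b))"
    using int by (intro product_integrable_prod) auto
  moreover have "(\<integral>y. (\<Prod>b\<in>Basis. ?g b (y b)) \<partial>(\<Pi>\<^sub>M b\<in>Basis. lborel)) = (\<Prod>b\<in>Basis. integral\<^sup>L lborel (?g b))"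
    using int by (intro product_integral_prod) auto
  ultimately have "has_bochner_integral (\<Pi>\<^sub>M b\<in>Basis. lborel) (\<lambda>y. \<Prod>b\<in>Basis. ?g b (y b))
      (\<Prod>b\<in>Basis. integral\<^sup>L lborel (?g b))"
    by (simp add: has_bochner_integral_iff)
  also have "(\<Prod>b\<in>Basis. integral\<^sup>L lborel (?g b)) = (\<Prod>i\<in>UNIV. I i)"
    by (simp add: reindex axis_eq_axis has_bochner_integral_integral_eq[OF f])
  also have "(\<lambda>y. \<Prod>b\<in>Basis. ?g b (y b))
      = (\<lambda>y. \<Prod>i\<in>UNIV. f i ((\<Sum>b\<in>Basis. y b *\<^sub>R b) $ i))"
  proof
    fix y :: "real ^ 'm \<Rightarrow> real"
    have "(\<Sum>b\<in>Basis. y b *\<^sub>R b) $ i = y (axis i 1)" for i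
      using inner_sum_left_Basis[of "axis i 1" y] by (simp add: inner_axis)
    then show "(\<Prod>b\<in>Basis. ?g b (y b)) = (\<Prod>i\<in>UNIV. f i ((\<Sum>b\<in>Basis. y b *\<^sub>R b) $ i))"
      by (simp add: reindex g)
  qed
  finally have pulled_back: "has_bochner_integral (\<Pi>\<^sub>M b\<in>Basis. lborel)
      (\<lambda>y. \<Prod>i\<in>UNIV. f i ((\<Sum>b\<in>Basis. y b *\<^sub>R b :: real ^ 'm) $ i)) (\<Prod>i\<in>UNIV. I i)" .
  have [measurable]: "f i \<in> borel_measurable borel" for i
    using borel_measurable_has_bochner_integral[OF f] by simp
  have [measurable]: "(\<lambda>x::real ^ 'm. x $ i) \<in> borel_measurable borel" for i
    by (intro borel_measurable_continuous_onI continuous_intros)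
  show ?thesis
    unfolding lborel_eq[where 'a = "real ^ 'm"]
    using pulled_back by (intro has_bochner_integral_distr) measurable
qed

lemma matrix_inv_mat:
  fixes c :: "'a::field"
  assumes "c \<noteq> 0"
  shows "matrix_inv (mat c :: 'a ^ 'n ^ 'n) = mat (inverse c)"
proof -
  have mult: "(mat a :: 'a ^ 'n ^ 'n) ** mat b = mat (a * b)" for a b
  proof -
    have "(\<Sum>k\<in>UNIV. (if i = k then a else 0) * (if k = j then b else 0)) = (if i = j then a * b else 0)"
      for i j :: 'n
    proof -
      have "(\<Sum>k\<in>UNIV. (if i = k then a else 0) * (if k = j then b else 0))
          = (\<Sum>k\<in>UNIV. if k = i then (if i = j then a * b else 0) else 0)"
        by (intro sum.cong) auto
      then show ?thesis by simp
    qed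
    then show ?thesis by (simp add: matrix_matrix_mult_def mat_def vec_eq_iff)
  qed
  have ex: "(mat c :: 'a ^ 'n ^ 'n) ** mat (inverse c) = mat 1 \<and> mat (inverse c) ** (mat c :: 'a ^ 'n ^ 'n) = mat 1"
    using assms by (simp add: mult)
  then have "mat c ** matrix_inv (mat c :: 'a ^ 'n ^ 'n) = mat 1"
    unfolding matrix_inv_def by (rule someI2) simp
  then have "mat (inverse c) ** (mat c ** matrix_inv (mat c :: 'a ^ 'n ^ 'n)) = mat (inverse c)"
    by simp
  then show ?thesis using ex by (simp add: matrix_mul_assoc)
qed

lemma mat_mult_vec: "(mat c :: 'a::comm_semiring_1 ^ 'n ^ 'n) *v x = c *s x"
proof -
  have "(\<Sum>j\<in>UNIV. (if i = j then c else 0) * x $ j) = (\<Sum>j\<in>UNIV. if j = i then c * x $ j else 0)" for i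
    by (intro sum.cong) auto
  then show ?thesis by (simp add: matrix_vector_mult_def mat_def vec_eq_iff)
qed

lemma det_mat: "det (mat c :: 'a::comm_ring_1 ^ 'n ^ 'n) = c ^ CARD('n)"
  by (subst det_diagonal) (auto simp: mat_def)

text \<open>
  For a scalar covariance matrix the coordinates are independent normal variables.
\<close>
lemma gaussian_density_spherical:
  fixes y \<mu> :: "real ^ 'm"
  assumes "\<sigma> > 0"
  shows "gaussian_density \<mu> (mat (\<sigma>\<^sup>2)) y = (\<Prod>i\<in>UNIV. normal_density (\<mu> $ i) \<sigma> (y $ i))"
proof -
  have "(\<Prod>i\<in>UNIV. normal_density (\<mu> $ i) \<sigma> (y $ i))
      = exp (\<Sum>i\<in>UNIV. - (y $ i - \<mu> $ i)\<^sup>2 / (2 * \<sigma>\<^sup>2)) / sqrt (2 * pi * \<sigma>\<^sup>2) ^ CARD('m)"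
    by (simp add: normal_density_def prod_dividef exp_sum power_divide)
  also have "(\<Sum>i\<in>UNIV. - (y $ i - \<mu> $ i)\<^sup>2 / (2 * \<sigma>\<^sup>2))
      = - ((y - \<mu>) \<bullet> (matrix_inv (mat (\<sigma>\<^sup>2)) *v (y - \<mu>))) / 2"
  proof -
    have "(y - \<mu>) \<bullet> (matrix_inv (mat (\<sigma>\<^sup>2)) *v (y - \<mu>)) = (\<Sum>i\<in>UNIV. (y $ i - \<mu> $ i)\<^sup>2) / \<sigma>\<^sup>2"
      using assms
      by (simp add: matrix_inv_mat mat_mult_vec inner_vec_def sum_divide_distrib
          power2_eq_square field_simps)
    then show ?thesis
      by (simp add: sum_negf flip: sum_divide_distrib)
  qed
  also have "sqrt (2 * pi * \<sigma>\<^sup>2) ^ CARD('m) = sqrt ((2 * pi) ^ CARD('m) * det (mat (\<sigma>\<^sup>2) :: real ^ 'm ^ 'm))"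
    by (simp add: det_mat power_mult_distrib flip: real_sqrt_power)
  finally show ?thesis by (simp add: gaussian_density_def)
qed

definition normal_central_moment :: "real \<Rightarrow> nat \<Rightarrow> real" where
  "normal_central_moment \<sigma> n = (\<integral>t. normal_density 0 \<sigma> t * t ^ n \<partial>lborel)"

lemma has_bochner_integral_normal_central_moment:
  assumes "\<sigma> > 0"
  shows "has_bochner_integral lborel (\<lambda>t. normal_density \<mu> \<sigma> t * (t - \<mu>) ^ n) (normal_central_moment \<sigma> n)"
proof (cases "even n")
  case True
  then obtain k where n: "n = 2 * k" by (elim evenE)
  show ?thesis
    using normal_moment_even[OF assms, of \<mu> k] normal_moment_even[OF assms, of 0 k]
    by (simp add: n normal_central_moment_def has_bochner_integral_iff)
next
  case False
  then obtain k where n: "n = 2 * k + 1" by (elim oddE)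
  show ?thesis
    using normal_moment_odd[OF assms, of \<mu> k] normal_moment_odd[OF assms, of 0 k]
    by (simp add: n normal_central_moment_def has_bochner_integral_iff)
qed

lemma normal_central_moment_odd: "\<sigma> > 0 \<Longrightarrow> odd n \<Longrightarrow> normal_central_moment \<sigma> n = 0"
  using normal_moment_odd[of \<sigma> 0]
  by (auto simp: normal_central_moment_def has_bochner_integral_iff elim!: oddE)

lemma normal_central_moment_0: "\<sigma> > 0 \<Longrightarrow> normal_central_moment \<sigma> 0 = 1"
  using normal_moment_even[of \<sigma> 0 0]
  by (auto simp: normal_central_moment_def has_bochner_integral_iff)

lemma normal_central_moment_2: "\<sigma> > 0 \<Longrightarrow> normal_central_moment \<sigma> 2 = \<sigma>\<^sup>2"
  using normal_moment_even[of \<sigma> 0 1]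
  by (auto simp: normal_central_moment_def has_bochner_integral_iff)

text \<open>
  Since the density is a product over coordinates, so is every central moment. The moments of order one,
  two and three below are the cases in which the exponent \<open>a\<close> is a sum of indicators of coordinates.
\<close>
lemma has_bochner_integral_gaussian_monomial:
  fixes \<mu> :: "real ^ 'm"
  assumes "\<sigma> > 0"
  shows "has_bochner_integral lborel
      (\<lambda>y. gaussian_density \<mu> (mat (\<sigma>\<^sup>2)) y * (\<Prod>i\<in>UNIV. ((y - \<mu>) $ i) ^ a i))
      (\<Prod>i\<in>UNIV. normal_central_moment \<sigma> (a i))"
  using has_bochner_integral_lborel_prod[of "\<lambda>i t. normal_density (\<mu> $ i) \<sigma> t * (t - \<mu> $ i) ^ a i",
      OF has_bochner_integral_normal_central_moment[OF assms]]
  by (simp add: gaussian_density_spherical[OF assms] prod.distrib)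

lemma has_bochner_integral_gaussian_0:
  fixes \<mu> :: "real ^ 'm"
  assumes "\<sigma> > 0"
  shows "has_bochner_integral lborel (gaussian_density \<mu> (mat (\<sigma>\<^sup>2))) 1"
  using has_bochner_integral_gaussian_monomial[OF assms, of \<mu> "\<lambda>_. 0"]
  by (simp add: normal_central_moment_0[OF assms])

lemma prod_power_delta:
  fixes f :: "'m::finite \<Rightarrow> 'a::comm_monoid_mult"
  shows "(\<Prod>l\<in>UNIV. f l ^ (of_bool (l = i))) = f i"
proof -
  have "(\<Prod>l\<in>UNIV. f l ^ (of_bool (l = i))) = (\<Prod>l\<in>UNIV. if l = i then f l else 1)"
    by (intro prod.cong) auto
  then show ?thesis by simp
qed

lemma has_bochner_integral_gaussian_1:
  fixes \<mu> :: "real ^ 'm"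
  assumes "\<sigma> > 0"
  shows "has_bochner_integral lborel (\<lambda>y. gaussian_density \<mu> (mat (\<sigma>\<^sup>2)) y * (y - \<mu>) $ i) 0"
proof -
  have "(\<Prod>l\<in>UNIV. normal_central_moment \<sigma> (of_bool (l = i))) = 0"
    using normal_central_moment_odd[OF assms] by (intro prod_zero bexI[of _ i]) auto
  then show ?thesis
    using has_bochner_integral_gaussian_monomial[OF assms, of \<mu> "\<lambda>l. of_bool (l = i)"]
    by (simp add: prod_power_delta del: vector_minus_component prod_zero_iff)
qed

lemma has_bochner_integral_gaussian_2:
  fixes \<mu> :: "real ^ 'm"
  assumes "\<sigma> > 0"
  shows "has_bochner_integral lborel
      (\<lambda>y. gaussian_density \<mu> (mat (\<sigma>\<^sup>2)) y * ((y - \<mu>) $ i * (y - \<mu>) $ j))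
      (if i = j then \<sigma>\<^sup>2 else 0)"
proof -
  let ?a = "\<lambda>l. of_bool (l = i) + of_bool (l = j)"
  have "(\<Prod>l\<in>UNIV. normal_central_moment \<sigma> (?a l)) = (if i = j then \<sigma>\<^sup>2 else 0)"
  proof (cases "i = j")
    case True
    have "(\<Prod>l\<in>UNIV. normal_central_moment \<sigma> (?a l)) = (\<Prod>l\<in>UNIV. if l = j then \<sigma>\<^sup>2 else 1)"
      using True normal_central_moment_0[OF assms] normal_central_moment_2[OF assms]
      by (intro prod.cong) (auto simp: numeral_2_eq_2)
    then show ?thesis using True by simp
  next
    case False
    then show ?thesis
      using normal_central_moment_odd[OF assms] by (simp, intro bexI[of _ i] exI[of _ i]) auto
  qed
  then show ?thesis
    using has_bochner_integral_gaussian_monomial[OF assms, of \<mu> ?a]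
    by (simp add: prod_power_delta power_add prod.distrib del: vector_minus_component prod_zero_iff)
qed

text \<open>
  The exponents add up to three, so at least one coordinate has an odd exponent and contributes a zero
  factor.
\<close>
lemma has_bochner_integral_gaussian_3:
  fixes \<mu> :: "real ^ 'm"
  assumes "\<sigma> > 0"
  shows "has_bochner_integral lborel
      (\<lambda>y. gaussian_density \<mu> (mat (\<sigma>\<^sup>2)) y * ((y - \<mu>) $ i * (y - \<mu>) $ j * (y - \<mu>) $ k)) 0"
proof -
  let ?a = "\<lambda>l. of_bool (l = i) + of_bool (l = j) + of_bool (l = k)"
  have "\<exists>l. odd (?a l :: nat)"
    by (cases "i = j"; cases "i = k"; cases "j = k"; force)
  then have "(\<Prod>l\<in>UNIV. normal_central_moment \<sigma> (?a l)) = 0"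
    using normal_central_moment_odd[OF assms] by (auto intro!: prod_zero)
  then show ?thesis
    using has_bochner_integral_gaussian_monomial[OF assms, of \<mu> ?a]
    by (simp add: prod_power_delta power_add prod.distrib del: vector_minus_component prod_zero_iff)
qed

lemma cdot_cvec_left: "cdot (cvec u) a = (\<Sum>i\<in>UNIV. (u $ i) *\<^sub>R a $ i)"
  by (simp add: cdot_def cvec_def scaleR_conv_of_real)

text \<open>
  A product of three affine functions covers every moment that occurs in the mixture: constant factors
  give the mean and the second moments. Write each factor as its value at \<open>\<mu>\<close> plus a centred linear form
  and expand: terms of odd degree in the centred forms integrate to zero, and a pair of centred forms with
  coefficient vectors \<open>a\<close> and \<open>b\<close> integrates to \<open>\<sigma>\<^sup>2 * cdot a b\<close>.
\<close>
lemma has_bochner_integral_gaussian_affine3: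
  fixes \<mu> :: "real ^ 'm" and a b c :: "complex ^ 'm" and \<alpha> \<beta> \<gamma> :: complex
  assumes \<sigma>: "\<sigma> > 0"
  defines "A \<equiv> \<alpha> + cdot (cvec \<mu>) a" and "B \<equiv> \<beta> + cdot (cvec \<mu>) b" and "C \<equiv> \<gamma> + cdot (cvec \<mu>) c"
  shows "has_bochner_integral lborel
      (\<lambda>y. gaussian_density \<mu> (mat (\<sigma>\<^sup>2)) y *\<^sub>R
        ((\<alpha> + cdot (cvec y) a) * (\<beta> + cdot (cvec y) b) * (\<gamma> + cdot (cvec y) c)))
      (A * B * C + of_real (\<sigma>\<^sup>2) * (A * cdot b c + B * cdot a c + C * cdot a b))"
proof -
  let ?g = "gaussian_density \<mu> (mat (\<sigma>\<^sup>2))"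
  let ?L = "\<lambda>a y. cdot (cvec (y - \<mu>)) a"
  have h0: "has_bochner_integral lborel (\<lambda>y. ?g y *\<^sub>R k) k" for k :: complex
    using has_bochner_integral_scaleR_left[OF has_bochner_integral_gaussian_0[OF \<sigma>, of \<mu>], of k]
    by simp
  have h1: "has_bochner_integral lborel (\<lambda>y. ?g y *\<^sub>R (k * ?L a y)) 0" for k a
  proof -
    have "has_bochner_integral lborel
        (\<lambda>y. \<Sum>i\<in>UNIV. (?g y * (y - \<mu>) $ i) *\<^sub>R (k * a $ i)) (\<Sum>i\<in>UNIV. 0 *\<^sub>R (k * a $ i))"
      by (intro has_bochner_integral_sum has_bochner_integral_scaleR_left
          has_bochner_integral_gaussian_1[OF \<sigma>])
    then show ?thesis
      by (simp add: cdot_cvec_left sum_distrib_left scaleR_sum_right del: vector_minus_component)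
  qed
  have h2: "has_bochner_integral lborel (\<lambda>y. ?g y *\<^sub>R (k * (?L a y * ?L b y)))
      (k * (of_real (\<sigma>\<^sup>2) * cdot a b))" for k a b
  proof -
    have "has_bochner_integral lborel
        (\<lambda>y. \<Sum>i\<in>UNIV. \<Sum>j\<in>UNIV. (?g y * ((y - \<mu>) $ i * (y - \<mu>) $ j)) *\<^sub>R (k * (a $ i * b $ j)))
        (\<Sum>i\<in>UNIV. \<Sum>j\<in>UNIV. (if i = j then \<sigma>\<^sup>2 else 0) *\<^sub>R (k * (a $ i * b $ j)))"
      by (intro has_bochner_integral_sum has_bochner_integral_scaleR_left
          has_bochner_integral_gaussian_2[OF \<sigma>])
    also have "(\<Sum>i\<in>UNIV. \<Sum>j\<in>UNIV. (if i = j then \<sigma>\<^sup>2 else 0) *\<^sub>R (k * (a $ i * b $ j)))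
        = (\<Sum>i\<in>UNIV. \<Sum>j\<in>UNIV. if j = i then of_real (\<sigma>\<^sup>2) * (k * (a $ i * b $ j)) else 0)"
      by (intro sum.cong) (auto simp: scaleR_conv_of_real)
    also have "\<dots> = k * (of_real (\<sigma>\<^sup>2) * cdot a b)"
      by (simp add: cdot_def sum_distrib_left mult_ac)
    also have "(\<lambda>y. \<Sum>i\<in>UNIV. \<Sum>j\<in>UNIV.
          (?g y * ((y - \<mu>) $ i * (y - \<mu>) $ j)) *\<^sub>R (k * (a $ i * b $ j)))
        = (\<lambda>y. ?g y *\<^sub>R (k * (?L a y * ?L b y)))"
      unfolding cdot_cvec_left sum_product
      by (simp add: sum_distrib_left scaleR_sum_right mult_ac del: vector_minus_component)
    finally show ?thesis .
  qed
  have h3: "has_bochner_integral lborel (\<lambda>y. ?g y *\<^sub>R (?L a y * ?L b y * ?L c y)) 0"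
  proof -
    have "has_bochner_integral lborel
        (\<lambda>y. \<Sum>i\<in>UNIV. \<Sum>k\<in>UNIV. \<Sum>j\<in>UNIV.
          (?g y * ((y - \<mu>) $ i * (y - \<mu>) $ j * (y - \<mu>) $ k)) *\<^sub>R (a $ i * b $ j * c $ k))
        (\<Sum>i\<in>UNIV. \<Sum>k\<in>UNIV. \<Sum>j\<in>UNIV. 0 *\<^sub>R (a $ i * b $ j * c $ k))"
      by (intro has_bochner_integral_sum has_bochner_integral_scaleR_left
          has_bochner_integral_gaussian_3[OF \<sigma>])
    also have "(\<lambda>y. \<Sum>i\<in>UNIV. \<Sum>k\<in>UNIV. \<Sum>j\<in>UNIV.
          (?g y * ((y - \<mu>) $ i * (y - \<mu>) $ j * (y - \<mu>) $ k)) *\<^sub>R (a $ i * b $ j * c $ k))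
        = (\<lambda>y. ?g y *\<^sub>R (?L a y * ?L b y * ?L c y))"
      unfolding cdot_cvec_left sum_product
      by (simp add: sum_distrib_left sum_distrib_right scaleR_sum_right mult_ac del: vector_minus_component)
    finally show ?thesis by simp
  qed
  have cvec_y: "cdot (cvec y) a = cdot (cvec \<mu>) a + ?L a y" for y a
    by (simp add: cdot_cvec_left scaleR_diff_left sum_subtractf)
  have expand: "(\<alpha> + cdot (cvec y) a) * (\<beta> + cdot (cvec y) b) * (\<gamma> + cdot (cvec y) c)
      = A * B * C + (A * B) * ?L c y + (A * C) * ?L b y + (B * C) * ?L a y
        + A * (?L b y * ?L c y) + B * (?L a y * ?L c y) + C * (?L a y * ?L b y)
        + ?L a y * ?L b y * ?L c y" for y
    unfolding A_def B_def C_def cvec_y[of y] by algebra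
  have "has_bochner_integral lborel
      (\<lambda>y. ?g y *\<^sub>R (A * B * C) + ?g y *\<^sub>R ((A * B) * ?L c y) + ?g y *\<^sub>R ((A * C) * ?L b y)
        + ?g y *\<^sub>R ((B * C) * ?L a y) + ?g y *\<^sub>R (A * (?L b y * ?L c y))
        + ?g y *\<^sub>R (B * (?L a y * ?L c y)) + ?g y *\<^sub>R (C * (?L a y * ?L b y))
        + ?g y *\<^sub>R (?L a y * ?L b y * ?L c y))
      (A * B * C + 0 + 0 + 0 + A * (of_real (\<sigma>\<^sup>2) * cdot b c) + B * (of_real (\<sigma>\<^sup>2) * cdot a c)
        + C * (of_real (\<sigma>\<^sup>2) * cdot a b) + 0)"
    by (intro has_bochner_integral_add h0 h1 h2 h3)
  then show ?thesis
    unfolding expand by (simp add: scaleR_add_right algebra_simps)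
qed

section \<open>Moments of mixtures of spherical Gaussians\<close>

lemma gaussian_density_spherical_nonneg:
  "\<sigma> > 0 \<Longrightarrow> gaussian_density \<mu> (mat (\<sigma>\<^sup>2)) y \<ge> 0"
  by (simp add: gaussian_density_spherical prod_nonneg)

lemma sqnorm_form_eq_cdot: "sqnorm_form X = cdot X X"
  by (simp add: sqnorm_form_def cdot_def power2_eq_square)

lemma continuous_on_cdot_cvec: "continuous_on S (\<lambda>y. cdot (cvec y) a)"
  unfolding cdot_cvec_left by (intro continuous_intros)

locale spherical_gaussian_mixture =
  fixes r :: nat and P :: "'a measure" and x :: "'a \<Rightarrow> real ^ 'm"
    and \<omega> \<sigma> :: "nat \<Rightarrow> real" and \<mu> :: "nat \<Rightarrow> real ^ 'm"
  assumes density: "distributed P lborel x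
      (\<lambda>y. ennreal (\<Sum>j=1..r. \<omega> j * gaussian_density (\<mu> j) (mat ((\<sigma> j)\<^sup>2)) y))"
    and sum_weights: "(\<Sum>j=1..r. \<omega> j) = 1"
    and variance_pos: "\<And>j. j \<in> {1..r} \<Longrightarrow> (\<sigma> j)\<^sup>2 > 0"
    and weight_pos: "\<And>j. j \<in> {1..r} \<Longrightarrow> \<omega> j > 0"
begin

definition mean :: "real ^ 'm" where
  "mean = (\<Sum>j=1..r. \<omega> j *\<^sub>R \<mu> j)"

definition mean_variance :: real where
  "mean_variance = (\<Sum>j=1..r. \<omega> j * (\<sigma> j)\<^sup>2)"

lemma has_bochner_integral_affine3:
  fixes a b c :: "complex ^ 'm" and \<alpha> \<beta> \<gamma> :: complex
  defines "A \<equiv> \<lambda>j. \<alpha> + cdot (cvec (\<mu> j)) a"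
    and "B \<equiv> \<lambda>j. \<beta> + cdot (cvec (\<mu> j)) b"
    and "C \<equiv> \<lambda>j. \<gamma> + cdot (cvec (\<mu> j)) c"
  shows "has_bochner_integral P
      (\<lambda>s. (\<alpha> + cdot (cvec (x s)) a) * (\<beta> + cdot (cvec (x s)) b) * (\<gamma> + cdot (cvec (x s)) c))
      (\<Sum>j=1..r. of_real (\<omega> j) *
        (A j * B j * C j + of_real ((\<sigma> j)\<^sup>2) * (A j * cdot b c + B j * cdot a c + C j * cdot a b)))"
proof -
  let ?g = "\<lambda>j. gaussian_density (\<mu> j) (mat ((\<sigma> j)\<^sup>2))"
  let ?F = "\<lambda>y. (\<alpha> + cdot (cvec y) a) * (\<beta> + cdot (cvec y) b) * (\<gamma> + cdot (cvec y) c)"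
  let ?V = "\<lambda>j. A j * B j * C j + of_real ((\<sigma> j)\<^sup>2) * (A j * cdot b c + B j * cdot a c + C j * cdot a b)"
  \<comment> \<open>only the square of the scale is known to be positive\<close>
  have abs_pos: "\<bar>\<sigma> j\<bar> > 0" if "j \<in> {1..r}" for j
    using variance_pos[OF that] by simp
  have g_meas: "?g j \<in> borel_measurable borel" and g_nonneg: "?g j y \<ge> 0" if "j \<in> {1..r}" for j y
    using borel_measurable_has_bochner_integral[OF has_bochner_integral_gaussian_0[OF abs_pos[OF that]], of "\<mu> j"]
      gaussian_density_spherical_nonneg[OF abs_pos[OF that], of "\<mu> j" y]
    by simp_all
  have F_meas: "?F \<in> borel_measurable borel"
    by (intro borel_measurable_continuous_onI continuous_intros continuous_on_cdot_cvec)
  have "has_bochner_integral lborel (\<lambda>y. \<Sum>j=1..r. \<omega> j *\<^sub>R (?g j y *\<^sub>R ?F y)) (\<Sum>j=1..r. \<omega> j *\<^sub>R ?V j)"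
  proof (intro has_bochner_integral_sum has_bochner_integral_scaleR_right)
    fix j assume "j \<in> {1..r}"
    from has_bochner_integral_gaussian_affine3[OF abs_pos[OF this], of "\<mu> j" \<alpha> a \<beta> b \<gamma> c]
    show "has_bochner_integral lborel (\<lambda>y. ?g j y *\<^sub>R ?F y) (?V j)"
      by (simp add: A_def B_def C_def)
  qed
  then have "has_bochner_integral lborel (\<lambda>y. (\<Sum>j=1..r. \<omega> j * ?g j y) *\<^sub>R ?F y) (\<Sum>j=1..r. \<omega> j *\<^sub>R ?V j)"
    by (simp add: scaleR_sum_left)
  then have "has_bochner_integral (density lborel (\<lambda>y. ennreal (\<Sum>j=1..r. \<omega> j * ?g j y))) ?F
      (\<Sum>j=1..r. \<omega> j *\<^sub>R ?V j)"
    using F_meas g_meas g_nonneg weight_pos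
    by (intro has_bochner_integral_density)
      (auto intro!: borel_measurable_sum borel_measurable_times sum_nonneg mult_nonneg_nonneg simp: less_imp_le)
  then have "has_bochner_integral (distr P lborel x) ?F (\<Sum>j=1..r. \<omega> j *\<^sub>R ?V j)"
    using density by (simp add: distributed_def)
  moreover have "x \<in> measurable P lborel"
    using density by (simp add: distributed_def)
  ultimately have "has_bochner_integral P (\<lambda>s. ?F (x s)) (\<Sum>j=1..r. \<omega> j *\<^sub>R ?V j)"
    using F_meas by (simp add: has_bochner_integral_iff integrable_distr_eq integral_distr)
  then show ?thesis by (simp add: scaleR_conv_of_real)
qed

lemma expectation: "integral\<^sup>L P x = mean"
proof -
  have "has_bochner_integral P (\<lambda>s. x s $ i) (mean $ i)" for i
  proof -
    have "has_bochner_integral P (\<lambda>s. of_real (x s $ i) :: complex) (of_real (mean $ i))"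
      using has_bochner_integral_affine3[of 0 "axis i 1" 1 0 1 0]
      by (simp add: cdot_axis_right cvec_def mean_def)
    from has_bochner_integral_bounded_linear[OF bounded_linear_Re this]
    show ?thesis by simp
  qed
  then have "has_bochner_integral P (\<lambda>s. \<Sum>i\<in>UNIV. (x s $ i) *\<^sub>R axis i (1::real))
      (\<Sum>i\<in>UNIV. (mean $ i) *\<^sub>R axis i 1)"
    by (intro has_bochner_integral_sum has_bochner_integral_scaleR_left) simp
  then have "has_bochner_integral P x mean"
    by (simp only: scalar_mult_eq_scaleR[symmetric] basis_expansion)
  then show ?thesis by (rule has_bochner_integral_integral_eq)
qed

text \<open>
  The covariance splits into the spread of the centres around their mean and the averaged variance times
  the identity.
\<close>
lemma covariance_entry:
  "covariance_matrix P x $ i $ j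
    = (\<Sum>k=1..r. \<omega> k * ((\<mu> k - mean) $ i * (\<mu> k - mean) $ j)) + (if i = j then mean_variance else 0)"
proof -
  \<comment> \<open>with this constant term the affine function is a coordinate of the centred variable\<close>
  let ?\<alpha> = "\<lambda>i. - complex_of_real (mean $ i)"
  have axis: "?\<alpha> i + cdot (cvec u) (axis i 1) = of_real ((u - mean) $ i)" for u i
    by (simp add: cdot_axis_right cvec_def)
  have cdot_axis: "cdot (axis i 1) (axis j 1) = (if i = j then 1 else 0)" for i j :: 'm
    unfolding cdot_axis_right by (simp add: axis_def)
  have "has_bochner_integral P
      (\<lambda>s. of_real ((x s - mean) $ i) * of_real ((x s - mean) $ j) :: complex)
      (\<Sum>k=1..r. of_real (\<omega> k) * (of_real ((\<mu> k - mean) $ i) * of_real ((\<mu> k - mean) $ j)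
         + of_real ((\<sigma> k)\<^sup>2) * (if i = j then 1 else 0)))"
    using has_bochner_integral_affine3[of "?\<alpha> i" "axis i 1" "?\<alpha> j" "axis j 1" 1 0]
    unfolding axis cdot_axis
    by (simp only: cdot_zero_right add_0_right mult_1_right mult_1_left mult_zero_right add_0_left)
  from has_bochner_integral_bounded_linear[OF bounded_linear_Re this]
  have "has_bochner_integral P (\<lambda>s. (x s - mean) $ i * (x s - mean) $ j)
      (\<Sum>k=1..r. \<omega> k * ((\<mu> k - mean) $ i * (\<mu> k - mean) $ j + (\<sigma> k)\<^sup>2 * (if i = j then 1 else 0)))"
    by (simp flip: of_real_mult of_real_power of_real_diff of_real_add split: if_splits)
  then have "covariance_matrix P x $ i $ j
      = (\<Sum>k=1..r. \<omega> k * ((\<mu> k - mean) $ i * (\<mu> k - mean) $ j + (\<sigma> k)\<^sup>2 * (if i = j then 1 else 0)))"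
    by (simp add: covariance_matrix_def expectation has_bochner_integral_integral_eq)
  then show ?thesis
    by (simp add: mean_variance_def distrib_left sum.distrib)
qed

lemma covariance_mult_vec:
  "covariance_matrix P x *v u
    = (\<Sum>k=1..r. (\<omega> k * ((\<mu> k - mean) \<bullet> u)) *\<^sub>R (\<mu> k - mean)) + mean_variance *\<^sub>R u"
proof (rule vec_eq_iff[THEN iffD2], rule allI)
  fix i
  let ?d = "\<lambda>k. \<mu> k - mean"
  have "(covariance_matrix P x *v u) $ i
      = (\<Sum>j\<in>UNIV. ((\<Sum>k=1..r. \<omega> k * (?d k $ i * ?d k $ j)) + (if i = j then mean_variance else 0)) * u $ j)"
    by (simp add: matrix_vector_mult_def covariance_entry)
  also have "\<dots> = (\<Sum>j\<in>UNIV. \<Sum>k=1..r. \<omega> k * (?d k $ i * ?d k $ j) * u $ j)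
      + (\<Sum>j\<in>UNIV. if j = i then mean_variance * u $ j else 0)"
    unfolding sum.distrib[symmetric]
    by (intro sum.cong) (auto simp: distrib_right sum_distrib_right)
  also have "(\<Sum>j\<in>UNIV. \<Sum>k=1..r. \<omega> k * (?d k $ i * ?d k $ j) * u $ j)
      = (\<Sum>k=1..r. (\<omega> k * (?d k \<bullet> u)) * ?d k $ i)"
    by (subst sum.swap) (simp add: inner_vec_def sum_distrib_left sum_distrib_right mult_ac)
  finally show "(covariance_matrix P x *v u) $ i
      = ((\<Sum>k=1..r. (\<omega> k * (?d k \<bullet> u)) *\<^sub>R ?d k) + mean_variance *\<^sub>R u) $ i"
    by simp
qed

lemma covariance_quadratic_form:
  "(covariance_matrix P x *v u) \<bullet> u
    = (\<Sum>k=1..r. \<omega> k * ((\<mu> k - mean) \<bullet> u)\<^sup>2) + mean_variance * (u \<bullet> u)"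
  unfolding covariance_mult_vec
  by (simp only: inner_add_left inner_sum_left inner_scaleR_left power2_eq_square mult.assoc)

text \<open>
  The weighted deviations sum to zero, so the first one is a combination of the other \<open>r - 1\<close>, and these
  cannot span a space of dimension at least \<open>r\<close>.
\<close>
lemma exists_orthogonal_to_deviations:
  assumes "1 \<le> r" and "r \<le> CARD('m)"
  obtains u where "u \<noteq> 0" and "\<And>k. k \<in> {1..r} \<Longrightarrow> (\<mu> k - mean) \<bullet> u = 0"
proof -
  let ?d = "\<lambda>k. \<mu> k - mean"
  let ?S = "?d ` {2..r}"
  have "dim ?S \<le> card ?S" by (intro dim_le_card') simp
  also have "\<dots> \<le> r - 1" using card_image_le[of "{2..r}" ?d] by simp
  also have "\<dots> < DIM(real ^ 'm)" using assms by simp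
  finally obtain u where u: "u \<noteq> 0" and orth: "\<And>y. y \<in> span ?S \<Longrightarrow> orthogonal u y"
    using orthogonal_to_subspace_exists by blast
  have tail: "?d k \<bullet> u = 0" if "k \<in> {2..r}" for k
    using orth[OF span_base[OF imageI[OF that]]] unfolding orthogonal_def by (simp only: inner_commute)
  have split: "{1..r} = insert 1 {2..r}" using assms by auto
  have "(\<Sum>k=1..r. \<omega> k *\<^sub>R ?d k) = 0"
    using sum_weights by (simp add: scaleR_diff_right sum_subtractf mean_def flip: scaleR_sum_left)
  then have "0 = (\<Sum>k=1..r. \<omega> k * (?d k \<bullet> u))"
    by (metis (no_types, lifting) inner_scaleR_left inner_sum_left inner_zero_left sum.cong)
  also have "\<dots> = \<omega> 1 * (?d 1 \<bullet> u)"
    unfolding split using tail by simp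
  finally have "?d 1 \<bullet> u = 0" using weight_pos[of 1] assms by simp
  then have "?d k \<bullet> u = 0" if "k \<in> {1..r}" for k
    using that tail unfolding split by blast
  with u show ?thesis by (rule that)
qed

text \<open>
  The spread of the centres is positive semidefinite, so no eigenvalue is below \<open>mean_variance\<close>; a vector
  orthogonal to all deviations attains it.
\<close>
lemma smallest_eigenvalue_covariance:
  assumes "1 \<le> r" and "r \<le> CARD('m)"
  shows "smallest_eigenvalue (covariance_matrix P x) = mean_variance"
  unfolding smallest_eigenvalue_def
proof (rule Least_equality)
  obtain u where "u \<noteq> 0" and "\<And>k. k \<in> {1..r} \<Longrightarrow> (\<mu> k - mean) \<bullet> u = 0"
    using exists_orthogonal_to_deviations[OF assms] by blast
  then show "is_eigenvalue (covariance_matrix P x) mean_variance"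
    unfolding is_eigenvalue_def by (intro exI[of _ u]) (simp add: covariance_mult_vec del: inner_diff_left)
next
  fix l assume "is_eigenvalue (covariance_matrix P x) l"
  then obtain u where u: "u \<noteq> 0" "covariance_matrix P x *v u = l *\<^sub>R u"
    by (auto simp: is_eigenvalue_def)
  have "mean_variance * (u \<bullet> u) \<le> (covariance_matrix P x *v u) \<bullet> u"
    unfolding covariance_quadratic_form using weight_pos by (auto intro!: sum_nonneg simp: less_imp_le)
  also have "\<dots> = l * (u \<bullet> u)" by (simp add: u)
  finally show "mean_variance \<le> l" using u by simp
qed

text \<open>
  The quadratic form of the spread vanishes at such an eigenvector, and it is a sum of squares with
  positive weights.
\<close>
lemma smallest_eigenvector_orthogonal:
  assumes "covariance_matrix P x *v v = mean_variance *\<^sub>R v" and k: "k \<in> {1..r}"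
  shows "(\<mu> k - mean) \<bullet> v = 0"
proof -
  have "(\<Sum>k=1..r. \<omega> k * ((\<mu> k - mean) \<bullet> v)\<^sup>2) = 0"
    using covariance_quadratic_form[of v] by (simp add: assms)
  then have "\<omega> k * ((\<mu> k - mean) \<bullet> v)\<^sup>2 = 0"
    using k weight_pos by (subst (asm) sum_nonneg_eq_0_iff) (auto simp: less_imp_le)
  then show ?thesis using weight_pos[OF k] by simp
qed

text \<open>
  As \<open>v\<close> is orthogonal to all deviations, the factor \<open>v \<bullet> (x - mean)\<close> is centred under each component, not
  only on average. In the expansion of the moment only the variance along \<open>v\<close> is then left, multiplied by
  the value of the linear form at the centre.
\<close>
lemma moment1_eq:
  assumes "1 \<le> r" and "r \<le> CARD('m)" and "norm v = 1"
    and "covariance_matrix P x *v v = smallest_eigenvalue (covariance_matrix P x) *\<^sub>R v"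
  shows "moment1 P x v X = (\<Sum>j=1..r. of_real (\<omega> j * (\<sigma> j)\<^sup>2) * cdot (cvec (\<mu> j)) X)"
proof -
  \<comment> \<open>with this constant term the affine function is \<open>v\<close> applied to the centred variable\<close>
  let ?\<beta> = "- complex_of_real (mean \<bullet> v)"
  have affine: "?\<beta> + cdot (cvec u) (cvec v) = of_real (v \<bullet> (u - mean))" for u
    by (simp add: cdot_cvec inner_diff_right inner_commute)
  have orth: "v \<bullet> (\<mu> k - mean) = 0" if "k \<in> {1..r}" for k
    using smallest_eigenvector_orthogonal[of v k] that assms
    by (simp add: smallest_eigenvalue_covariance inner_commute)
  have unit: "cdot (cvec v) (cvec v) = 1"
    using \<open>norm v = 1\<close> by (simp add: cdot_cvec norm_eq_1)
  have "has_bochner_integral P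
      (\<lambda>s. cdot (cvec (x s)) X * of_real (v \<bullet> (x s - mean)) * of_real (v \<bullet> (x s - mean)))
      (\<Sum>j=1..r. of_real (\<omega> j) * (of_real ((\<sigma> j)\<^sup>2) * cdot (cvec (\<mu> j)) X))"
  proof -
    have "(\<Sum>j=1..r. of_real (\<omega> j) * (cdot (cvec (\<mu> j)) X * of_real (v \<bullet> (\<mu> j - mean)) * of_real (v \<bullet> (\<mu> j - mean))
        + of_real ((\<sigma> j)\<^sup>2) * (cdot (cvec (\<mu> j)) X * 1 + of_real (v \<bullet> (\<mu> j - mean)) * cdot X (cvec v)
          + of_real (v \<bullet> (\<mu> j - mean)) * cdot X (cvec v))))
      = (\<Sum>j=1..r. complex_of_real (\<omega> j) * (of_real ((\<sigma> j)\<^sup>2) * cdot (cvec (\<mu> j)) X))"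
      by (intro sum.cong refl) (simp add: orth del: inner_diff_right)
    then show ?thesis
      using has_bochner_integral_affine3[of 0 X ?\<beta> "cvec v" ?\<beta> "cvec v"]
      unfolding affine unit by simp
  qed
  then have "(\<integral>s. cdot (cvec (x s)) X * of_real (v \<bullet> (x s - mean)) * of_real (v \<bullet> (x s - mean)) \<partial>P)
      = (\<Sum>j=1..r. of_real (\<omega> j) * (of_real ((\<sigma> j)\<^sup>2) * cdot (cvec (\<mu> j)) X))"
    by (rule has_bochner_integral_integral_eq)
  then show ?thesis
    by (simp add: moment1_def expectation power2_eq_square mult.assoc)
qed

lemma moment2_eq:
  assumes "1 \<le> r" and "r \<le> CARD('m)"
  shows "moment2 P x X = (\<Sum>j=1..r. of_real (\<omega> j) * cdot (cvec (\<mu> j)) X ^ 2)"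
proof -
  have "has_bochner_integral P (\<lambda>s. cdot (cvec (x s)) X ^ 2)
      (\<Sum>j=1..r. of_real (\<omega> j) * (cdot (cvec (\<mu> j)) X ^ 2 + of_real ((\<sigma> j)\<^sup>2) * sqnorm_form X))"
    using has_bochner_integral_affine3[of 0 X 0 X 1 0]
    by (simp add: power2_eq_square sqnorm_form_eq_cdot)
  then have "(\<integral>s. cdot (cvec (x s)) X ^ 2 \<partial>P)
      = (\<Sum>j=1..r. of_real (\<omega> j) * (cdot (cvec (\<mu> j)) X ^ 2 + of_real ((\<sigma> j)\<^sup>2) * sqnorm_form X))"
    by (rule has_bochner_integral_integral_eq)
  then show ?thesis
    by (simp add: moment2_def smallest_eigenvalue_covariance[OF assms] mean_variance_def
        distrib_left sum.distrib sum_distrib_right mult.assoc)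
qed

text \<open>
  The third moment of a component centred at \<open>\<mu> j\<close> is the cube of \<open>cdot (cvec (\<mu> j)) X\<close> plus
  \<open>3 * (\<sigma> j)\<^sup>2 * cdot (cvec (\<mu> j)) X * sqnorm_form X\<close>; averaged over the components, the second part is the
  correction made with \<open>moment1\<close>.
\<close>
lemma moment3_eq:
  assumes "1 \<le> r" and "r \<le> CARD('m)" and "norm v = 1"
    and "covariance_matrix P x *v v = smallest_eigenvalue (covariance_matrix P x) *\<^sub>R v"
  shows "moment3 P x v X = (\<Sum>j=1..r. of_real (\<omega> j) * cdot (cvec (\<mu> j)) X ^ 3)"
proof -
  have "has_bochner_integral P (\<lambda>s. cdot (cvec (x s)) X ^ 3)
      (\<Sum>j=1..r. of_real (\<omega> j) * (cdot (cvec (\<mu> j)) X ^ 3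
        + 3 * sqnorm_form X * (of_real ((\<sigma> j)\<^sup>2) * cdot (cvec (\<mu> j)) X)))"
    using has_bochner_integral_affine3[of 0 X 0 X 0 X]
    by (simp add: power3_eq_cube sqnorm_form_eq_cdot algebra_simps)
  then have "(\<integral>s. cdot (cvec (x s)) X ^ 3 \<partial>P)
      = (\<Sum>j=1..r. of_real (\<omega> j) * (cdot (cvec (\<mu> j)) X ^ 3
        + 3 * sqnorm_form X * (of_real ((\<sigma> j)\<^sup>2) * cdot (cvec (\<mu> j)) X)))"
    by (rule has_bochner_integral_integral_eq)
  then show ?thesis
    by (simp add: moment3_def moment1_eq[OF assms] distrib_left sum.distrib sum_distrib_left mult_ac)
qed

end

section \<open>Identifiability of the third moment tensor\<close>

theorem proposition3p3:
  fixes r :: nat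
    and P :: "'a measure"
    and x :: "'a \<Rightarrow> real ^ 'm"
    and \<omega> \<sigma> :: "nat \<Rightarrow> real"
    and \<mu> :: "nat \<Rightarrow> real ^ 'm"
    and v :: "real ^ 'm"
  assumes "1 \<le> r" and "r \<le> CARD('m)"
    and "prob_space P"
    and "distributed P lborel x
           (\<lambda>y. ennreal (\<Sum>j=1..r. \<omega> j * gaussian_density (\<mu> j) (mat ((\<sigma> j)\<^sup>2)) y))"
    and "(\<Sum>j=1..r. \<omega> j) = 1"
    and "\<forall>j\<in>{1..r}. (\<sigma> j)\<^sup>2 > 0"
    and "\<forall>j\<in>{1..r}. \<omega> j > 0"
    and "inj_on \<mu> {1..r}" and "independent (\<mu> ` {1..r})"
    and "norm v = 1"
    and "covariance_matrix P x *v v = smallest_eigenvalue (covariance_matrix P x) *\<^sub>R v"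
  shows "identifiable 3 (moment3 P x v)
    \<and> waring_rank 3 (moment3 P x v) = r
    \<and> (\<forall>X. moment1 P x v X
            = (\<Sum>i=1..r. complex_of_real (\<omega> i * (\<sigma> i)\<^sup>2) * cdot (cvec (\<mu> i)) X))
    \<and> (\<forall>X. moment2 P x X
            = (\<Sum>i=1..r. complex_of_real (\<omega> i) * (cdot (cvec (\<mu> i)) X) ^ 2))
    \<and> (\<forall>X. moment3 P x v X
            = (\<Sum>i=1..r. complex_of_real (\<omega> i) * (cdot (cvec (\<mu> i)) X) ^ 3))
    \<and> (\<forall>(\<omega>' :: nat \<Rightarrow> complex) (\<mu>' :: nat \<Rightarrow> complex ^ 'm) (\<tau> :: nat \<Rightarrow> complex).
          (\<forall>X. moment3 P x v X = (\<Sum>i=1..r. \<omega>' i * (cdot (\<mu>' i) X) ^ 3)) \<and>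
          (\<forall>X. moment2 P x X = (\<Sum>i=1..r. \<omega>' i * (cdot (\<mu>' i) X) ^ 2)) \<and>
          (\<forall>X. moment1 P x v X = (\<Sum>i=1..r. \<omega>' i * \<tau> i * cdot (\<mu>' i) X))
          \<longrightarrow> (\<exists>\<pi>. \<pi> permutes {1..r} \<and>
                 (\<forall>i\<in>{1..r}. \<omega>' i = complex_of_real (\<omega> (\<pi> i)) \<and> \<mu>' i = cvec (\<mu> (\<pi> i)))))"
proof -
  interpret spherical_gaussian_mixture r P x \<omega> \<sigma> \<mu>
    using assms(4-7) by unfold_locales auto
  let ?w = "\<lambda>i. complex_of_real (\<omega> i)" and ?\<mu> = "\<lambda>i. cvec (\<mu> i)"
  obtain e where dual: "dual_vectors {1..r} ?\<mu> e"
    using real_independent_imp_dual_vectors[OF assms(9,8)] .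
  have w: "\<forall>i\<in>{1..r}. ?w i \<noteq> 0"
    using assms(7) by auto
  note eigenvector = assms(1,2,10,11)
  have T: "decomposition 3 (moment3 P x v) r ?w ?\<mu>"
    unfolding decomposition_def using moment3_eq[OF eigenvector] by blast
  have Q: "decomposition 2 (moment2 P x) r ?w ?\<mu>"
    unfolding decomposition_def using moment2_eq[OF assms(1,2)] by blast
  show ?thesis
  proof (intro conjI allI impI)
    show "identifiable 3 (moment3 P x v)" by (rule identifiable_cubic[OF dual w T])
    show "waring_rank 3 (moment3 P x v) = r" by (rule waring_rank_cubic[OF dual w T])
  next
    fix \<omega>' :: "nat \<Rightarrow> complex" and \<mu>' :: "nat \<Rightarrow> complex ^ 'm" and \<tau> :: "nat \<Rightarrow> complex"
    assume decomp: "(\<forall>X. moment3 P x v X = (\<Sum>i=1..r. \<omega>' i * (cdot (\<mu>' i) X) ^ 3)) \<and>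
      (\<forall>X. moment2 P x X = (\<Sum>i=1..r. \<omega>' i * (cdot (\<mu>' i) X) ^ 2)) \<and>
      (\<forall>X. moment1 P x v X = (\<Sum>i=1..r. \<omega>' i * \<tau> i * cdot (\<mu>' i) X))"
    have "decomposition 3 (moment3 P x v) r \<omega>' \<mu>'"
      unfolding decomposition_def using decomp by (rule conjunct1)
    moreover have "decomposition 2 (moment2 P x) r \<omega>' \<mu>'"
      unfolding decomposition_def using decomp by (rule conjunct2[THEN conjunct1])
    ultimately show "\<exists>\<pi>. \<pi> permutes {1..r} \<and>
        (\<forall>i\<in>{1..r}. \<omega>' i = complex_of_real (\<omega> (\<pi> i)) \<and> \<mu>' i = cvec (\<mu> (\<pi> i)))"
      by (rule square_and_cube_decomposition_unique[OF dual w T _ Q])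
  qed (rule moment1_eq[OF eigenvector] moment2_eq[OF assms(1,2)] moment3_eq[OF eigenvector])+
qed

end
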